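(* Let $\mathcal{H}_1,\mathcal{H}_2$ be separable Hilbert spaces, let $M:\mathcal{H}_1\to\mathcal{H}_2$ be a bounded linear operator with closed range, and let $W\subseteq\mathcal{H}_1$, $V\subseteq\mathcal{H}_2$ be closed subspaces with $\mathcal{H}_1=W\oplus\ker(M)$ and $\mathcal{H}_2=\operatorname{ran}(M)\oplus V$. For a mapping $N:\mathcal{H}_2\to\mathcal{H}_1$ the following two definitions are equivalent: (a) $MN=\pi_{\operatorname{ran}(M),V}$, $NM=\pi_{W,\ker(M)}$, and $\operatorname{ran}(N)=W$; (b) for every $y\in\mathcal{H}_2$, $Ny=x_y$, where $x_y$ is the unique element of $W$ for which there is a $z_y\in V$ with $y=Mx_y+z_y$.
   Context: $X\oplus Z$ denotes a direct sum, not necessarily orthogonal. If a Hilbert space $\mathcal{H}=X\oplus Z$ with $X,Z$ closed subspaces, $\pi_{X,Z}$ is the oblique projection onto $X$ along $Z$: $\pi_{X,Z}(x+z)=x$ for $x\in X$, $z\in Z$. Under the stated hypotheses, for each $y\in\mathcal{H}_2$ there exist unique $x_y\in W$ and $z_y\in V$ with $y=Mx_y+z_y$, so (b) makes sense. The mapping given by (a), respectively (b), is what is called the oblique pseudoinverse of $M$ on $W$ along $V$. *)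

theory Defs
  imports "HOL-Analysis.Analysis"
begin

(* The scalar field, real or complex. The library has Hilbert spaces over the reals only, so the
   field is kept generic here; up to isomorphism the reals and the complex numbers, with their
   usual conjugation, are the only models of these axioms. *)
class hilbert_scalar = real_normed_field +
  fixes scnj :: "'a \<Rightarrow> 'a"
  assumes scnj_add: "scnj (a + b) = scnj a + scnj b"
    and scnj_mult: "scnj (a * b) = scnj a * scnj b"
    and scnj_scnj: "scnj (scnj a) = a"
    and mult_scnj: "a * scnj a = (norm a)\<^sup>2 *\<^sub>R 1"

instantiation real :: hilbert_scalar
begin

definition scnj_real :: "real \<Rightarrow> real" where "scnj_real a = a"

instance
  by standard (simp_all add: scnj_real_def power2_eq_square)

end

instantiation complex :: hilbert_scalar
begin

definition scnj_complex :: "complex \<Rightarrow> complex" where "scnj_complex a = cnj a"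

instance
  by standard (simp_all add: scnj_complex_def complex_norm_square[symmetric] scaleR_conv_of_real)

end

(* A Hilbert space over 'k: the complete norm of the carrier type is the one given by the inner
   product ip (linear in the first argument), and the real scalar multiplication of the type is
   the restriction of scale. Positive definiteness of ip is contained in ip_self. *)
locale hilbert_space = vector_space scale
  for scale :: "'k::hilbert_scalar \<Rightarrow> 'a::{real_normed_vector,complete_space} \<Rightarrow> 'a" +
  fixes ip :: "'a \<Rightarrow> 'a \<Rightarrow> 'k"
  assumes scale_of_real: "scale (of_real r) x = r *\<^sub>R x"
    and ip_add_left: "ip (x + y) z = ip x z + ip y z"
    and ip_scale_left: "ip (scale c x) y = c * ip x y"
    and ip_commute: "ip x y = scnj (ip y x)"
    and ip_self: "ip x x = of_real ((norm x)\<^sup>2)"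

lemma hilbert_space_real:
  "hilbert_space (scaleR :: real \<Rightarrow> 'a \<Rightarrow> 'a::{real_inner,complete_space}) inner"
  by unfold_locales
    (simp_all add: inner_add_left inner_commute scnj_real_def power2_norm_eq_inner algebra_simps)

lemma hilbert_space_complex:
  "hilbert_space ((*) :: complex \<Rightarrow> complex \<Rightarrow> complex) (\<lambda>x y. x * cnj y)"
  by unfold_locales
    (simp_all add: scnj_complex_def complex_norm_square[symmetric] scaleR_conv_of_real algebra_simps)

(* The whole space is the direct sum, not necessarily orthogonal, of X and Z. *)
definition is_direct_sum :: "'a::ab_group_add set \<Rightarrow> 'a set \<Rightarrow> bool" where
  "is_direct_sum X Z \<longleftrightarrow> {x + z |x z. x \<in> X \<and> z \<in> Z} = UNIV \<and> X \<inter> Z = {0}"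

definition oblique_proj :: "'a::ab_group_add set \<Rightarrow> 'a set \<Rightarrow> 'a \<Rightarrow> 'a" where
  "oblique_proj X Z y = (THE x. x \<in> X \<and> (\<exists>z\<in>Z. y = x + z))"

lemma (in module) is_direct_sum_unique:
  assumes "subspace X" "subspace Z" "is_direct_sum X Z"
    and "x \<in> X" "x' \<in> X" "z \<in> Z" "z' \<in> Z" "x + z = x' + z'"
  shows "x = x'" "z = z'"
proof -
  have "x - x' = z' - z"
    using assms(8) by (simp add: algebra_simps)
  moreover have "x - x' \<in> X" "z' - z \<in> Z"
    using assms by (auto intro: subspace_diff)
  ultimately have "x - x' \<in> X \<inter> Z" by simp
  then have "x - x' \<in> {0}" using assms(3) unfolding is_direct_sum_def by blast
  then show "x = x'" by simp
  then show "z = z'" using assms(8) by simp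
qed

lemma (in module) oblique_proj_add:
  assumes "subspace X" "subspace Z" "is_direct_sum X Z" "x \<in> X" "z \<in> Z"
  shows "oblique_proj X Z (x + z) = x"
  unfolding oblique_proj_def
  using assms is_direct_sum_unique(1)[OF assms(1-3)] by (intro the_equality) blast+

lemma ex1_oblique_preimage:
  assumes "Vector_Spaces.linear s1 s2 M"
    and "module.subspace s1 W" "module.subspace s2 V"
    and "is_direct_sum W {x. M x = 0}" "is_direct_sum (range M) V"
  shows "\<exists>!x. x \<in> W \<and> (\<exists>z\<in>V. y = M x + z)"
proof -
  interpret Vector_Spaces.linear s1 s2 M by fact
  have ran: "vs2.subspace (range M)"
    using vs1.subspace_UNIV by (rule subspace_image)
  have "y \<in> {x + z |x z. x \<in> range M \<and> z \<in> V}"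
    using assms(5) by (simp add: is_direct_sum_def)
  then obtain u z where y: "y = M u + z" "z \<in> V" by auto
  have "u \<in> {x + z |x z. x \<in> W \<and> z \<in> {x. M x = 0}}"
    using assms(4) by (simp add: is_direct_sum_def)
  then obtain w k where u: "u = w + k" "w \<in> W" "M k = 0" by auto
  show ?thesis
  proof (rule ex1I[of _ w])
    show "w \<in> W \<and> (\<exists>z\<in>V. y = M w + z)"
      using y u by (auto simp: add)
  next
    fix x assume x: "x \<in> W \<and> (\<exists>z\<in>V. y = M x + z)"
    then obtain z' where z': "z' \<in> V" "y = M x + z'" by auto
    have "M x = M w"
      using vs2.is_direct_sum_unique(1)[OF ran assms(3,5), of "M x" "M w" z' z] y u z'
      by (simp add: add)
    then have "x - w \<in> W \<inter> {x. M x = 0}"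
      using x u assms(2) by (simp add: diff vs1.subspace_diff)
    then have "x - w \<in> {0}"
      using assms(4) unfolding is_direct_sum_def by blast
    then show "x = w" by simp
  qed
qed

end

theory Submission
  imports Defs
begin

text \<open>Since \<open>W\<close> is a complement of the kernel, \<open>M\<close> maps
  \<open>W\<close> bijectively onto \<open>range M\<close>. Hence every \<open>y\<close> is
  \<open>M x + z\<close> with a unique \<open>x\<close> in \<open>W\<close> and some
  \<open>z\<close> in \<open>V\<close> (\<open>ex1_oblique_preimage\<close>). Both descriptions say
  that \<open>N\<close> inverts this bijection on \<open>range M\<close> and ignores the
  \<open>V\<close>-component. From (a), \<open>N y\<close> is shown to be an admissible
  \<open>x\<close>, so uniqueness identifies it. From (b), the identities in (a) are read off from
  the decomposition, with \<open>oblique_proj_add\<close> evaluating the projections.\<close>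

theorem proposition3p6:
  fixes scale1 :: "'k::hilbert_scalar \<Rightarrow> 'a::{real_normed_vector,complete_space} \<Rightarrow> 'a"
    and ip1 :: "'a \<Rightarrow> 'a \<Rightarrow> 'k"
    and scale2 :: "'k \<Rightarrow> 'b::{real_normed_vector,complete_space} \<Rightarrow> 'b"
    and ip2 :: "'b \<Rightarrow> 'b \<Rightarrow> 'k"
    and M :: "'a \<Rightarrow> 'b" and N :: "'b \<Rightarrow> 'a"
    and W :: "'a set" and V :: "'b set"
  assumes "hilbert_space scale1 ip1" and "separable_space (euclidean :: 'a topology)"
    and "hilbert_space scale2 ip2" and "separable_space (euclidean :: 'b topology)"
    and "Vector_Spaces.linear scale1 scale2 M" and "bounded_linear M" and "closed (range M)"
    and "module.subspace scale1 W" and "closed W"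
    and "module.subspace scale2 V" and "closed V"
    and "is_direct_sum W {x. M x = 0}"
    and "is_direct_sum (range M) V"
  shows "(M \<circ> N = oblique_proj (range M) V \<and> N \<circ> M = oblique_proj W {x. M x = 0} \<and> range N = W)
     \<longleftrightarrow> (\<forall>y. N y = (THE x. x \<in> W \<and> (\<exists>z\<in>V. y = M x + z)))"
proof -
  interpret Vector_Spaces.linear scale1 scale2 M by fact
  let ?K = "{x. M x = 0}" and ?P = "\<lambda>y x. x \<in> W \<and> (\<exists>z\<in>V. y = M x + z)"
  have ran: "vs2.subspace (range M)"
    using vs1.subspace_UNIV by (rule subspace_image)
  have ker: "vs1.subspace ?K"
    by (rule subspace_kernel)
  have ex1: "\<exists>!x. ?P y x" for y
    using assms by (intro ex1_oblique_preimage)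
  have proj_ran: "oblique_proj (range M) V (M x + z) = M x" if "z \<in> V" for x z
    using vs2.oblique_proj_add[OF ran assms(10,13) _ that] by simp
  have proj_W: "oblique_proj W ?K (w + k) = w" if "w \<in> W" "M k = 0" for w k
    using vs1.oblique_proj_add[OF assms(8) ker assms(12)] that by simp
  show ?thesis
  proof
    assume a: "M \<circ> N = oblique_proj (range M) V \<and> N \<circ> M = oblique_proj W ?K \<and> range N = W"
    show "\<forall>y. N y = (THE x. ?P y x)"
    proof
      fix y
      obtain x z where y: "z \<in> V" "y = M x + z"
        using ex1[of y] by blast
      then have "M (N y) = M x"
        using a proj_ran by (metis comp_apply)
      \<comment> \<open>The same \<open>z\<close> serves as witness, since
        \<open>y = M x + z = M (N y) + z\<close>; membership in \<open>W\<close> comes from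
        \<open>range N = W\<close>.\<close>
      then have "?P y (N y)"
        using a y by auto
      then show "N y = (THE x. ?P y x)"
        by (rule the1_equality[OF ex1, symmetric])
    qed
  next
    assume "\<forall>y. N y = (THE x. ?P y x)"
    then have P: "?P y (N y)" for y
      using theI'[OF ex1] by simp
    \<comment> \<open>Both \<open>w\<close> and \<open>N (M w + z)\<close> are admissible for the
      vector \<open>M w + z\<close>, so they coincide.\<close>
    have N_eq: "N (M w + z) = w" if "w \<in> W" "z \<in> V" for w z
      using ex1[of "M w + z"] P[of "M w + z"] that by blast
    \<comment> \<open>The decomposition of \<open>y\<close> given by \<open>P\<close> already
      displays \<open>M (N y)\<close> as its component in \<open>range M\<close>.\<close>
    have "M (N y) = oblique_proj (range M) V y" for y
      using P[of y] proj_ran by metis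
    moreover have "N (M x) = oblique_proj W ?K x" for x
    proof -
      have "x \<in> {w + k |w k. w \<in> W \<and> k \<in> ?K}"
        using assms(12) by (simp add: is_direct_sum_def)
      then obtain w k where x: "x = w + k" "w \<in> W" "M k = 0" by auto
      \<comment> \<open>\<open>M\<close> kills \<open>k\<close>, so \<open>M x = M w + 0\<close>
        with \<open>0\<close> in \<open>V\<close>.\<close>
      then have "N (M x) = w"
        using N_eq[of w 0] vs2.subspace_0[OF assms(10)] by (simp add: add)
      then show ?thesis using x proj_W by simp
    qed
    \<comment> \<open>Values of \<open>N\<close> lie in \<open>W\<close> by \<open>P\<close>;
      conversely each \<open>w\<close> in \<open>W\<close> is \<open>N (M w + 0)\<close>.\<close>
    moreover have "range N = W"
      using P N_eq vs2.subspace_0[OF assms(10)] by (metis image_subsetI rangeI subsetI subset_antisym)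
    ultimately show "M \<circ> N = oblique_proj (range M) V \<and> N \<circ> M = oblique_proj W ?K \<and> range N = W"
      by auto
  qed
qed

end
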